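(* Let $Y$ be a random variable (the label) taking values in a finite set $\mathcal{Y}$, let $Z$ be a random variable (the data representation) with arbitrary distribution, and let $V$ be a random variable (a certain view of the data), all defined jointly on a common probability space. Let $$P_e = 1 - \mathbb{E}_{z\sim p(Z)}\left[\max_{y\in \mathcal{Y}} p(y\mid z)\right]$$ be the Bayes error rate of the representation $Z$ with respect to the label $Y$. Then $$P_e \;\leq\; 1 - e^{-(H(Y) - I(Z;Y))} \;\leq\; 1 - e^{-(H(Y) - I(Z;Y;V) - I(Z;Y\mid V))}.$$
   Context: Here $p(y\mid z)$ denotes the conditional probability $\Pr(Y=y\mid Z=z)$. $H(Y)$ is the Shannon entropy of $Y$, $I(Z;Y)$ is the mutual information of $Z$ and $Y$, and $I(Z;Y\mid V)$ is the conditional mutual information of $Z$ and $Y$ given $V$, all computed with natural logarithms. $I(Z;Y;V)$ is the three-variable mutual information (interaction information), with the sign convention $I(Z;Y;V) = I(Z;Y) - I(Z;Y\mid V)$. The Bayes error rate is the lowest error achievable by any classifier predicting $Y$ from $Z$. *)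

theory Defs
  imports "HOL-Probability.Probability"
begin

text \<open>
  Regular version of $z \mapsto \Pr(Y = y \mid Z = z)$, for a random variable $Z$ with an arbitrary
  distribution: the Radon-Nikodym derivative of $A \mapsto \Pr(Y = y, Z \in A)$ with respect to the
  distribution of $Z$. It is determined up to a null set of that distribution.
\<close>

definition (in prob_space) cond_prob_at ::
    "'b measure \<Rightarrow> ('a \<Rightarrow> 'b) \<Rightarrow> ('a \<Rightarrow> 'c) \<Rightarrow> 'c \<Rightarrow> 'b \<Rightarrow> real" where
  "cond_prob_at MZ Z Y y z =
    enn2real (RN_deriv (distr M MZ Z)
      (distr (density M (indicator {\<omega> \<in> space M. Y \<omega> = y})) MZ Z) z)"

lemma (in prob_space) cond_prob_at_integral:
  assumes Z [measurable]: "Z \<in> measurable M MZ"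
    and Y [measurable]: "{\<omega> \<in> space M. Y \<omega> = y} \<in> sets M"
    and A [measurable]: "A \<in> sets MZ"
  shows "(LINT z:A|distr M MZ Z. cond_prob_at MZ Z Y y z) = prob {\<omega> \<in> space M. Y \<omega> = y \<and> Z \<omega> \<in> A}"
proof -
  let ?P = "distr M MZ Z"
  let ?S = "{\<omega> \<in> space M. Y \<omega> = y}"
  let ?N = "distr (density M (indicator ?S)) MZ Z"
  interpret P: prob_space ?P by (rule prob_space_distr) (rule Z)
  have N: "emeasure ?N B = emeasure M {\<omega> \<in> space M. Y \<omega> = y \<and> Z \<omega> \<in> B}" if "B \<in> sets MZ" for B
  proof -
    have [measurable]: "B \<in> sets MZ" by fact
    have "emeasure ?N B = (\<integral>\<^sup>+\<omega>. indicator ?S \<omega> * indicator (Z -` B \<inter> space M) \<omega> \<partial>M)"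
      by (simp add: emeasure_distr emeasure_density)
    also have "\<dots> = (\<integral>\<^sup>+\<omega>. indicator (?S \<inter> (Z -` B \<inter> space M)) \<omega> \<partial>M)"
      by (intro nn_integral_cong) (auto split: split_indicator)
    also have "\<dots> = emeasure M (?S \<inter> (Z -` B \<inter> space M))"
      by (intro nn_integral_indicator) measurable
    also have "?S \<inter> (Z -` B \<inter> space M) = {\<omega> \<in> space M. Y \<omega> = y \<and> Z \<omega> \<in> B}" by auto
    finally show ?thesis .
  qed
  have ac: "absolutely_continuous ?P ?N"
  proof (unfold absolutely_continuous_def, rule subsetI)
    fix B assume "B \<in> null_sets ?P"
    then have B: "B \<in> sets MZ" "emeasure M (Z -` B \<inter> space M) = 0"
      by (auto simp: null_sets_def emeasure_distr)
    have "emeasure M {\<omega> \<in> space M. Y \<omega> = y \<and> Z \<omega> \<in> B} \<le> emeasure M (Z -` B \<inter> space M)"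
      using B by (intro emeasure_mono) (auto intro: measurable_sets)
    then show "B \<in> null_sets ?N" using B N by (auto simp: null_sets_def)
  qed
  have fin: "finite_measure ?N"
    by (rule finite_measureI) (simp add: N)
  have AEfin: "AE z in ?P. RN_deriv ?P ?N z \<noteq> \<infinity>"
    using fin ac by (intro P.RN_deriv_finite) (auto intro: finite_measure.axioms(1) simp: finite_measure.sigma_finite_measure)
  have dens: "density ?P (RN_deriv ?P ?N) = ?N"
    by (rule P.density_RN_deriv[OF ac]) simp
  have "(LINT z:A|?P. cond_prob_at MZ Z Y y z)
      = enn2real (\<integral>\<^sup>+z. ennreal (indicator A z * cond_prob_at MZ Z Y y z) \<partial>?P)"
    unfolding set_lebesgue_integral_def cond_prob_at_def
    by (subst integral_eq_nn_integral) (auto)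
  also have "(\<integral>\<^sup>+z. ennreal (indicator A z * cond_prob_at MZ Z Y y z) \<partial>?P)
      = (\<integral>\<^sup>+z. RN_deriv ?P ?N z * indicator A z \<partial>?P)"
    using AEfin by (intro nn_integral_cong_AE)
      (auto simp: cond_prob_at_def less_top split: split_indicator)
  also have "\<dots> = emeasure (density ?P (RN_deriv ?P ?N)) A"
    by (subst emeasure_density) auto
  also have "\<dots> = emeasure M {\<omega> \<in> space M. Y \<omega> = y \<and> Z \<omega> \<in> A}"
    by (simp add: dens N)
  finally show ?thesis by (simp add: measure_def)
qed

definition (in prob_space) bayes_error_rate ::
    "'b measure \<Rightarrow> 'c set \<Rightarrow> ('a \<Rightarrow> 'b) \<Rightarrow> ('a \<Rightarrow> 'c) \<Rightarrow> real" where
  "bayes_error_rate MZ C Z Y =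
    1 - (\<integral>z. Max ((\<lambda>y. cond_prob_at MZ Z Y y z) ` C) \<partial>distr M MZ Z)"

text \<open>
  $I(Z;Y;V) = I(Z;Y) - I(Z;Y \mid V)$. The symmetric quantity $I(Z;Y \mid V)$ is written with $Y$ in
  the first argument of \<^const>\<open>prob_space.conditional_mutual_information\<close>, which is the difference
  $I(Y;(Z,V)) - I(Y;V)$. For $Y$ with finitely many values both terms are finite whatever the
  distributions of $Z$ and $V$. The other order, $I(Z;(Y,V)) - I(Z;V)$, can be of the form
  $\infty - \infty$, and the library integral then returns the value 0 for divergent terms.
\<close>

definition (in prob_space) interaction_information ::
    "real \<Rightarrow> 'b measure \<Rightarrow> 'c measure \<Rightarrow> 'd measure \<Rightarrow> ('a \<Rightarrow> 'b) \<Rightarrow> ('a \<Rightarrow> 'c) \<Rightarrow> ('a \<Rightarrow> 'd) \<Rightarrow> real" where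
  "interaction_information b MZ MY MV Z Y V =
    mutual_information b MZ MY Z Y - conditional_mutual_information b MY MZ MV Y Z V"

end

theory Submission
  imports Defs
begin

text \<open>
  Writing $p_y(z) = p(y \mid z)$ and $m = \max_y p_y$, one has
  $-(H(Y) - I(Z;Y)) = \mathbb{E}[\sum_y p_y \ln p_y] \le \mathbb{E}[\ln m] \le \ln \mathbb{E}[m]$.
  The last two steps are merged: with $E = \mathbb{E}[m]$, the tangent bound
  $\ln t \le t - 1$ at $t = p_y / E$ gives $\ln p_y \le \ln E - 1 + m / E$, and averaging over $y$ and
  $Z$ yields $\ln E$. The second inequality is an equality, by the definition of $I(Z;Y;V)$.
\<close>

section \<open>Integration over the product with a finite counting measure\<close>

lemma nn_integral_pair_count_space:
  assumes C: "finite C" and P: "sigma_finite_measure P"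
    and f [measurable]: "f \<in> borel_measurable (P \<Otimes>\<^sub>M count_space C)"
  shows "(\<integral>\<^sup>+x. f x \<partial>(P \<Otimes>\<^sub>M count_space C)) = (\<Sum>y\<in>C. \<integral>\<^sup>+z. f (z, y) \<partial>P)"
proof -
  interpret P: sigma_finite_measure P by fact
  interpret C: sigma_finite_measure "count_space C" using C by (rule sigma_finite_measure_count_space_finite)
  interpret PC: pair_sigma_finite P "count_space C" ..
  show ?thesis
    using C by (simp add: PC.nn_integral_snd[symmetric] nn_integral_count_space_finite)
qed

text \<open>Integrability on the product comes for free from that of the sections: the nonnegative
  integral of the norm is a finite sum of finite integrals. Fubini then applies.\<close>

lemma integral_pair_count_space:
  fixes f :: "'z \<times> 'c \<Rightarrow> real"
  assumes C: "finite C" and P: "sigma_finite_measure P"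
    and f [measurable]: "f \<in> borel_measurable (P \<Otimes>\<^sub>M count_space C)"
    and int: "\<And>y. y \<in> C \<Longrightarrow> integrable P (\<lambda>z. f (z, y))"
  shows "(\<integral>x. f x \<partial>(P \<Otimes>\<^sub>M count_space C)) = (\<Sum>y\<in>C. \<integral>z. f (z, y) \<partial>P)"
proof -
  interpret P: sigma_finite_measure P by fact
  interpret C: sigma_finite_measure "count_space C" using C by (rule sigma_finite_measure_count_space_finite)
  interpret PC: pair_sigma_finite P "count_space C" ..
  have "integrable (P \<Otimes>\<^sub>M count_space C) f"
    using int C
    by (intro integrableI_bounded) (auto simp: nn_integral_pair_count_space[OF C P] integrable_iff_bounded)
  then show ?thesis
    using PC.integral_snd[of "\<lambda>z y. f (z, y)"] C by (simp add: lebesgue_integral_count_space_finite)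
qed

text \<open>The second coordinate takes only countably many values, so joint measurability reduces
  to that of each section. This turns a family of functions indexed by labels into one function on
  the product.\<close>

lemma measurable_pair_count_space:
  assumes "finite C" and "\<And>y. y \<in> C \<Longrightarrow> (\<lambda>z. f z y) \<in> measurable P N"
  shows "(\<lambda>(z, y). f z y) \<in> measurable (P \<Otimes>\<^sub>M count_space C) N"
  using measurable_compose_countable'[of C "\<lambda>y x. f (fst x) y" "P \<Otimes>\<^sub>M count_space C" N snd] assms
  by (auto simp: split_beta' intro: measurable_compose[OF measurable_fst] countable_finite)

text \<open>From \<open>ln (1 / p) \<le> 1 / p - 1\<close> one gets
  \<open>- p * ln p \<le> 1 - p\<close>. The uniform bound makes every entropy integrand below
  integrable.\<close>

lemma abs_mult_ln_le_1:
  fixes p :: real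
  assumes "0 \<le> p" "p \<le> 1"
  shows "\<bar>p * ln p\<bar> \<le> 1"
proof (cases "p = 0")
  case False
  then have p: "0 < p" using assms by simp
  have "- ln p \<le> 1 / p - 1"
    using ln_le_minus_one[of "1 / p"] p by (simp add: ln_div)
  then have "p * - ln p \<le> p * (1 / p - 1)"
    using p by (intro mult_left_mono) auto
  also have "\<dots> \<le> 1" using p by (simp add: field_simps)
  finally show ?thesis
    using p assms by (simp add: abs_mult ln_le_zero_iff abs_of_nonpos)
qed simp

section \<open>Conditional probabilities as functions of the representation\<close>

context prob_space
begin

lemma borel_measurable_cond_prob_at [measurable]:
  "cond_prob_at MZ Z Y y \<in> borel_measurable (distr M MZ Z)"
  unfolding cond_prob_at_def by measurable

lemma cond_prob_at_nonneg: "0 \<le> cond_prob_at MZ Z Y y z"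
  by (simp add: cond_prob_at_def)

lemma integrable_cond_prob_at:
  assumes [measurable]: "Z \<in> measurable M MZ" "{\<omega> \<in> space M. Y \<omega> = y} \<in> sets M"
  shows "integrable (distr M MZ Z) (cond_prob_at MZ Z Y y)"
proof -
  let ?P = "distr M MZ Z"
  let ?N = "distr (density M (indicator {\<omega> \<in> space M. Y \<omega> = y})) MZ Z"
  have "(\<integral>\<^sup>+z. ennreal (cond_prob_at MZ Z Y y z) \<partial>?P) \<le> (\<integral>\<^sup>+z. RN_deriv ?P ?N z \<partial>?P)"
    by (intro nn_integral_mono) (auto simp: cond_prob_at_def ennreal_enn2real_if)
  also have "\<dots> < \<infinity>"
  \<comment> \<open>The split replaces a proof of absolute continuity: if a density exists, the
    total mass is Pr(Y = y); otherwise \<open>RN_deriv\<close> is by definition the zero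
    function.\<close>
  proof (cases "\<exists>f. f \<in> borel_measurable ?P \<and> density ?P f = ?N")
    case True
    then have "density ?P (RN_deriv ?P ?N) = ?N"
      using RN_derivI by metis
    then have "(\<integral>\<^sup>+z. RN_deriv ?P ?N z \<partial>?P) = emeasure ?N (space ?P)"
      using emeasure_density[of "RN_deriv ?P ?N" ?P "space ?P"] by (auto intro!: nn_integral_cong)
    also have "\<dots> = emeasure (density M (indicator {\<omega> \<in> space M. Y \<omega> = y})) (space M)"
      by (subst emeasure_distr) (auto intro!: arg_cong2[where f = emeasure] dest: measurable_space[OF assms(1)])
    also have "\<dots> = emeasure M {\<omega> \<in> space M. Y \<omega> = y}"
      by (subst emeasure_restricted) (auto intro!: arg_cong2[where f = emeasure])
    finally show ?thesis by (simp add: less_top[symmetric])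
  next
    case False
    then have "RN_deriv ?P ?N = (\<lambda>_. 0)" unfolding RN_deriv_def by (rule if_not_P)
    then show ?thesis by simp
  qed
  finally show ?thesis
    by (intro integrableI_nonneg) (auto simp: cond_prob_at_nonneg)
qed

text \<open>The defining property in extended nonnegative form, suited to comparing measures given
  by densities. Integrability is what allows the passage, because the Bochner integral of a
  non-integrable function is 0 by default.\<close>

lemma nn_integral_cond_prob_at:
  assumes [measurable]: "Z \<in> measurable M MZ" "{\<omega> \<in> space M. Y \<omega> = y} \<in> sets M" "A \<in> sets MZ"
  shows "(\<integral>\<^sup>+z. ennreal (cond_prob_at MZ Z Y y z) * indicator A z \<partial>distr M MZ Z)
    = emeasure M {\<omega> \<in> space M. Y \<omega> = y \<and> Z \<omega> \<in> A}"
proof -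
  let ?P = "distr M MZ Z"
  have int: "integrable ?P (\<lambda>z. indicator A z * cond_prob_at MZ Z Y y z)"
    using integrable_mult_indicator[of A ?P "cond_prob_at MZ Z Y y"] integrable_cond_prob_at[OF assms(1,2)]
    by simp
  have "(\<integral>\<^sup>+z. ennreal (cond_prob_at MZ Z Y y z) * indicator A z \<partial>?P)
      = (\<integral>\<^sup>+z. ennreal (indicator A z * cond_prob_at MZ Z Y y z) \<partial>?P)"
    by (intro nn_integral_cong) (auto split: split_indicator)
  also have "\<dots> = ennreal (LINT z:A|?P. cond_prob_at MZ Z Y y z)"
    unfolding set_lebesgue_integral_def
    using int by (subst nn_integral_eq_integral) (auto simp: cond_prob_at_nonneg)
  finally show ?thesis
    by (simp add: cond_prob_at_integral emeasure_eq_measure)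
qed

lemma integral_cond_prob_at:
  assumes [measurable]: "Z \<in> measurable M MZ" "{\<omega> \<in> space M. Y \<omega> = y} \<in> sets M"
  shows "(\<integral>z. cond_prob_at MZ Z Y y z \<partial>distr M MZ Z) = prob {\<omega> \<in> space M. Y \<omega> = y}"
proof -
  have "{\<omega> \<in> space M. Y \<omega> = y \<and> Z \<omega> \<in> space MZ} = {\<omega> \<in> space M. Y \<omega> = y}"
    using measurable_space[OF assms(1)] by auto
  moreover have "(\<integral>z. cond_prob_at MZ Z Y y z \<partial>distr M MZ Z)
      = (LINT z:space MZ|distr M MZ Z. cond_prob_at MZ Z Y y z)"
    unfolding set_lebesgue_integral_def by (intro Bochner_Integration.integral_cong) auto
  ultimately show ?thesis
    using cond_prob_at_integral[OF assms, of "space MZ"] by simp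
qed

lemma emeasure_eq_sum_count_space:
  assumes C: "finite C" and Y [measurable]: "Y \<in> measurable M (count_space C)"
    and A [measurable]: "\<And>y. y \<in> C \<Longrightarrow> Measurable.pred M (\<lambda>\<omega>. A \<omega> y)"
  shows "emeasure M {\<omega> \<in> space M. A \<omega> (Y \<omega>)} = (\<Sum>y\<in>C. emeasure M {\<omega> \<in> space M. Y \<omega> = y \<and> A \<omega> y})"
proof -
  have "{\<omega> \<in> space M. A \<omega> (Y \<omega>)} = (\<Union>y\<in>C. {\<omega> \<in> space M. Y \<omega> = y \<and> A \<omega> y})"
    using measurable_space[OF Y] by auto
  then show ?thesis
    using C by (subst sum_emeasure) (auto simp: disjoint_family_on_def)
qed

text \<open>Both the sum and the constant 1 are densities of the law of \<open>Z\<close> with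
  respect to itself, and densities are unique almost everywhere. Each \<open>cond_prob_at\<close> is
  only one version of a derivative, chosen separately for every label, hence the exceptional null
  set.\<close>

lemma AE_sum_cond_prob_at:
  assumes C: "finite C" and Y [measurable]: "Y \<in> measurable M (count_space C)"
    and Z [measurable]: "Z \<in> measurable M MZ"
  shows "AE z in distr M MZ Z. (\<Sum>y\<in>C. cond_prob_at MZ Z Y y z) = 1"
proof -
  let ?P = "distr M MZ Z"
  interpret P: prob_space ?P by (rule prob_space_distr) (rule Z)
  have "density ?P (\<lambda>z. \<Sum>y\<in>C. ennreal (cond_prob_at MZ Z Y y z)) = density ?P (\<lambda>z. 1)"
  proof (rule measure_eqI)
    fix A assume "A \<in> sets (density ?P (\<lambda>z. \<Sum>y\<in>C. ennreal (cond_prob_at MZ Z Y y z)))"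
    then have A [measurable]: "A \<in> sets MZ" by simp
    have "emeasure (density ?P (\<lambda>z. \<Sum>y\<in>C. ennreal (cond_prob_at MZ Z Y y z))) A
        = (\<Sum>y\<in>C. emeasure M {\<omega> \<in> space M. Y \<omega> = y \<and> Z \<omega> \<in> A})"
      by (simp add: emeasure_density sum_distrib_right nn_integral_sum nn_integral_cond_prob_at)
    also have "\<dots> = emeasure M {\<omega> \<in> space M. Z \<omega> \<in> A}"
      by (rule emeasure_eq_sum_count_space[OF C Y, symmetric]) measurable
    also have "\<dots> = emeasure (density ?P (\<lambda>z. 1)) A"
      by (simp add: density_1 emeasure_distr vimage_def Int_def conj_commute)
    finally show "emeasure (density ?P (\<lambda>z. \<Sum>y\<in>C. ennreal (cond_prob_at MZ Z Y y z))) A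
        = emeasure (density ?P (\<lambda>z. 1)) A" .
  qed simp
  then have "AE z in ?P. (\<Sum>y\<in>C. ennreal (cond_prob_at MZ Z Y y z)) = 1"
    by (subst (asm) P.density_unique_iff) auto
  then show ?thesis
    by eventually_elim (simp add: sum_ennreal cond_prob_at_nonneg)
qed

lemma AE_cond_prob_at_le_1:
  assumes C: "finite C" and Y: "Y \<in> measurable M (count_space C)"
    and Z: "Z \<in> measurable M MZ" and y: "y \<in> C"
  shows "AE z in distr M MZ Z. cond_prob_at MZ Z Y y z \<le> 1"
  using AE_sum_cond_prob_at[OF C Y Z]
proof eventually_elim
  case (elim z)
  then show ?case
    using member_le_sum[of y C "\<lambda>y. cond_prob_at MZ Z Y y z"] C y by (simp add: cond_prob_at_nonneg)
qed

section \<open>Densities of the label and of the pair, entropy and mutual information\<close>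

lemma distributed_count_space_prob:
  assumes C: "finite C" and Y [measurable]: "Y \<in> measurable M (count_space C)"
  shows "distributed M (count_space C) Y (\<lambda>y. ennreal (prob {\<omega> \<in> space M. Y \<omega> = y}))"
  unfolding distributed_def
proof (intro conjI)
  show "distr M (count_space C) Y = density (count_space C) (\<lambda>y. ennreal (prob {\<omega> \<in> space M. Y \<omega> = y}))"
  proof (rule measure_eqI_finite)
    fix a assume a: "a \<in> C"
    then have "emeasure (density (count_space C) (\<lambda>y. ennreal (prob {\<omega> \<in> space M. Y \<omega> = y}))) {a}
        = ennreal (prob {\<omega> \<in> space M. Y \<omega> = a})"
      using C by (subst emeasure_density) (auto simp: nn_integral_count_space_finite indicator_def if_distrib sum.delta cong: if_cong)
    then show "emeasure (distr M (count_space C) Y) {a}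
        = emeasure (density (count_space C) (\<lambda>y. ennreal (prob {\<omega> \<in> space M. Y \<omega> = y}))) {a}"
      using a by (simp add: emeasure_distr emeasure_eq_measure vimage_def Int_def conj_commute)
  qed (use C in auto)
qed (use Y in auto)

lemma entropy_count_space:
  assumes C: "finite C" and Y: "Y \<in> measurable M (count_space C)" and b: "1 < b"
  shows "entropy b (count_space C) Y
    = - (\<Sum>y\<in>C. prob {\<omega> \<in> space M. Y \<omega> = y} * log b (prob {\<omega> \<in> space M. Y \<omega> = y}))"
proof -
  interpret information_space M b by standard (rule b)
  show ?thesis
    using entropy_distr[OF distributed_count_space_prob[OF C Y]] C
    by (simp add: lebesgue_integral_count_space_finite)
qed

text \<open>An arbitrary \<open>Z\<close> need not have a density with respect to a given reference
  measure, so its own law serves as the reference. Slicing an event along the values of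
  \<open>Y\<close> then shows that the joint density is p(y | z) itself.\<close>

lemma distributed_cond_prob_at:
  assumes C: "finite C" and Y [measurable]: "Y \<in> measurable M (count_space C)"
    and Z [measurable]: "Z \<in> measurable M MZ"
  shows "distributed M (distr M MZ Z \<Otimes>\<^sub>M count_space C) (\<lambda>\<omega>. (Z \<omega>, Y \<omega>))
    (\<lambda>x. ennreal (cond_prob_at MZ Z Y (snd x) (fst x)))"
  unfolding distributed_def
proof (intro conjI)
  let ?P = "distr M MZ Z"
  interpret P: prob_space ?P by (rule prob_space_distr) (rule Z)
  let ?f = "\<lambda>x. ennreal (cond_prob_at MZ Z Y (snd x) (fst x))"
  show f [measurable]: "?f \<in> borel_measurable (?P \<Otimes>\<^sub>M count_space C)"
    using measurable_pair_count_space[OF C, of "\<lambda>z y. ennreal (cond_prob_at MZ Z Y y z)" ?P borel]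
    by (simp add: split_beta')
  show m [measurable]: "(\<lambda>\<omega>. (Z \<omega>, Y \<omega>)) \<in> measurable M (?P \<Otimes>\<^sub>M count_space C)"
    by simp
  show "distr M (?P \<Otimes>\<^sub>M count_space C) (\<lambda>\<omega>. (Z \<omega>, Y \<omega>)) = density (?P \<Otimes>\<^sub>M count_space C) ?f"
  proof (rule measure_eqI)
    fix A assume "A \<in> sets (distr M (?P \<Otimes>\<^sub>M count_space C) (\<lambda>\<omega>. (Z \<omega>, Y \<omega>)))"
    then have A [measurable]: "A \<in> sets (?P \<Otimes>\<^sub>M count_space C)" by simp
    have sec [measurable]: "(\<lambda>z. (z, y)) -` A \<in> sets MZ" for y
      using sets_Pair1[OF A] sets_Pair2[OF A, of y] by simp
    have "emeasure (density (?P \<Otimes>\<^sub>M count_space C) ?f) A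
        = (\<Sum>y\<in>C. \<integral>\<^sup>+z. ennreal (cond_prob_at MZ Z Y y z) * indicator ((\<lambda>z. (z, y)) -` A) z \<partial>?P)"
      by (simp add: emeasure_density nn_integral_pair_count_space[OF C P.sigma_finite_measure_axioms])
        (simp add: indicator_def)
    also have "\<dots> = (\<Sum>y\<in>C. emeasure M {\<omega> \<in> space M. Y \<omega> = y \<and> Z \<omega> \<in> (\<lambda>z. (z, y)) -` A})"
      by (intro sum.cong refl nn_integral_cond_prob_at) measurable
    also have "\<dots> = emeasure M {\<omega> \<in> space M. Z \<omega> \<in> (\<lambda>z. (z, Y \<omega>)) -` A}"
      by (rule emeasure_eq_sum_count_space[OF C Y, symmetric]) measurable
    also have "\<dots> = emeasure (distr M (?P \<Otimes>\<^sub>M count_space C) (\<lambda>\<omega>. (Z \<omega>, Y \<omega>))) A"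
      by (subst emeasure_distr) (auto simp: vimage_def Int_def conj_commute)
    finally show "emeasure (distr M (?P \<Otimes>\<^sub>M count_space C) (\<lambda>\<omega>. (Z \<omega>, Y \<omega>))) A
        = emeasure (density (?P \<Otimes>\<^sub>M count_space C) ?f) A" ..
  qed simp
qed

text \<open>The definition uses \<open>S\<close> only through its space and measurable sets, which
  \<open>distr M S X\<close> shares. Hence the law of \<open>Z\<close> can replace \<open>MZ\<close>
  as the reference measure.\<close>

lemma mutual_information_distr_cong:
  "mutual_information b (distr M S X) T X Y = mutual_information b S T X Y"
proof -
  have "distr M (distr M S X) X = distr M S X"
    by (rule distr_cong) auto
  moreover have "distr M (distr M S X \<Otimes>\<^sub>M T) (\<lambda>x. (X x, Y x)) = distr M (S \<Otimes>\<^sub>M T) (\<lambda>x. (X x, Y x))"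
    by (rule distr_cong) (auto intro!: sets_pair_measure_cong)
  ultimately show ?thesis
    by (simp add: mutual_information_def)
qed

lemma integrable_cond_prob_at_ln:
  assumes C: "finite C" and Y: "Y \<in> measurable M (count_space C)"
    and Z: "Z \<in> measurable M MZ" and y: "y \<in> C"
  shows "integrable (distr M MZ Z) (\<lambda>z. cond_prob_at MZ Z Y y z * ln (cond_prob_at MZ Z Y y z))"
proof -
  interpret P: prob_space "distr M MZ Z" by (rule prob_space_distr) (rule Z)
  show ?thesis
  proof (rule P.integrable_const_bound[where B = 1])
    show "AE z in distr M MZ Z. norm (cond_prob_at MZ Z Y y z * ln (cond_prob_at MZ Z Y y z)) \<le> 1"
      using AE_cond_prob_at_le_1[OF assms]
      by eventually_elim (auto intro!: abs_mult_ln_le_1 simp: cond_prob_at_nonneg)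
  qed measurable
qed

text \<open>With q(y) = Pr(Y = y), I(Z;Y) is the sum over y of the integrals of p(y | z) ln (p(y |
  z) / q(y)). Splitting the logarithm, the part with q(y) integrates to H(Y) and cancels; all terms
  are finite, so the subtraction is legitimate.\<close>

lemma entropy_minus_mutual_information:
  assumes C: "finite C" and Y [measurable]: "Y \<in> measurable M (count_space C)"
    and Z [measurable]: "Z \<in> measurable M MZ"
  shows "entropy (exp 1) (count_space C) Y - mutual_information (exp 1) MZ (count_space C) Z Y
    = - (\<Sum>y\<in>C. \<integral>z. cond_prob_at MZ Z Y y z * ln (cond_prob_at MZ Z Y y z) \<partial>distr M MZ Z)"
proof -
  let ?P = "distr M MZ Z" and ?p = "cond_prob_at MZ Z Y"
  let ?q = "\<lambda>y. prob {\<omega> \<in> space M. Y \<omega> = y}"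
  interpret P: prob_space ?P by (rule prob_space_distr) (rule Z)
  interpret information_space M "exp 1" by standard simp
  have log_ln: "log (exp 1) x = ln x" for x :: real by (simp add: log_def)
  have Zd: "distributed M ?P Z (\<lambda>z. ennreal 1)"
  proof -
    have "distr M ?P Z = ?P" by (rule distr_cong) auto
    then show ?thesis by (simp add: distributed_def density_1)
  qed
  \<comment> \<open>The quotient rule for \<open>ln\<close> needs q(y) > 0. If q(y) = 0, then p(y |
    z), being nonnegative with integral q(y), vanishes almost everywhere and both sides are
    0.\<close>
  have AE_eq: "AE z in ?P. ?p y z * ln (?p y z / ?q y) = ?p y z * ln (?p y z) - ?p y z * ln (?q y)"
    if y: "y \<in> C" for y
  proof (cases "?q y = 0")
    case True
    then have "AE z in ?P. ?p y z = 0"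
      using integral_nonneg_eq_0_iff_AE[OF integrable_cond_prob_at[OF Z, of Y y]]
      by (simp add: cond_prob_at_nonneg integral_cond_prob_at)
    then show ?thesis by eventually_elim simp
  next
    case False
    then have "0 < ?q y" by (simp add: zero_less_measure_iff)
    then have "?p y z * ln (?p y z / ?q y) = ?p y z * ln (?p y z) - ?p y z * ln (?q y)" for z
      using cond_prob_at_nonneg[of MZ Z Y y z]
      by (cases "?p y z = 0") (auto simp: ln_div right_diff_distrib)
    then show ?thesis by simp
  qed
  have int_diff: "integrable ?P (\<lambda>z. ?p y z * ln (?p y z) - ?p y z * ln (?q y))" if "y \<in> C" for y
    using integrable_cond_prob_at_ln[OF C Y Z that] integrable_cond_prob_at[OF Z, of Y y]
    by (intro Bochner_Integration.integrable_diff integrable_mult_left) auto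
  have int: "integrable ?P (\<lambda>z. ?p y z * ln (?p y z / ?q y))" if "y \<in> C" for y
  proof (rule integrable_cong_AE_imp[OF int_diff[OF that]])
    show "AE z in ?P. ?p y z * ln (?p y z) - ?p y z * ln (?q y) = ?p y z * ln (?p y z / ?q y)"
      using AE_eq[OF that] by eventually_elim (rule sym)
  qed measurable
  have "mutual_information (exp 1) MZ (count_space C) Z Y
      = mutual_information (exp 1) ?P (count_space C) Z Y"
    by (simp add: mutual_information_distr_cong)
  \<comment> \<open>The factor 1 is the density of \<open>Z\<close> with respect to its own
    law.\<close>
  also have "\<dots> = (\<integral>x. ?p (snd x) (fst x) * log (exp 1) (?p (snd x) (fst x) / (1 * ?q (snd x)))
      \<partial>(?P \<Otimes>\<^sub>M count_space C))"
    using sigma_finite_measure_count_space_finite[OF C]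
    by (intro mutual_information_distr[OF P.sigma_finite_measure_axioms _ Zd _
          distributed_count_space_prob[OF C Y] _ distributed_cond_prob_at[OF C Y Z]])
      (auto simp: cond_prob_at_nonneg)
  also have "\<dots> = (\<Sum>y\<in>C. \<integral>z. ?p y z * ln (?p y z / ?q y) \<partial>?P)"
    using measurable_pair_count_space[OF C, of "\<lambda>z y. ?p y z * ln (?p y z / ?q y)" ?P borel] int
    by (subst integral_pair_count_space[OF C P.sigma_finite_measure_axioms])
      (auto simp: split_beta' log_ln)
  also have "\<dots> = (\<Sum>y\<in>C. (\<integral>z. ?p y z * ln (?p y z) \<partial>?P) - ?q y * ln (?q y))"
  proof (intro sum.cong refl)
    fix y assume y: "y \<in> C"
    have "(\<integral>z. ?p y z * ln (?p y z / ?q y) \<partial>?P) = (\<integral>z. ?p y z * ln (?p y z) - ?p y z * ln (?q y) \<partial>?P)"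
      using AE_eq[OF y] by (intro integral_cong_AE) auto
    then show "(\<integral>z. ?p y z * ln (?p y z / ?q y) \<partial>?P) = (\<integral>z. ?p y z * ln (?p y z) \<partial>?P) - ?q y * ln (?q y)"
      using integrable_cond_prob_at_ln[OF C Y Z y] integrable_cond_prob_at[OF Z, of Y y]
      by (simp add: integral_cond_prob_at)
  qed
  finally show ?thesis
    by (simp add: entropy_count_space[OF C Y] log_ln sum_subtractf)
qed

section \<open>The bound on the Bayes error\<close>

lemma bayes_error_rate_le:
  assumes C: "finite C" and Y [measurable]: "Y \<in> measurable M (count_space C)"
    and Z [measurable]: "Z \<in> measurable M MZ"
  shows "bayes_error_rate MZ C Z Y \<le> 1 - exp (- (entropy (exp 1) (count_space C) Y
    - mutual_information (exp 1) MZ (count_space C) Z Y))"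
proof -
  let ?P = "distr M MZ Z" and ?p = "cond_prob_at MZ Z Y"
  define m where "m z = Max ((\<lambda>y. ?p y z) ` C)" for z
  define E where "E = (\<integral>z. m z \<partial>?P)"
  interpret P: prob_space ?P by (rule prob_space_distr) (rule Z)
  \<comment> \<open>A probability space has a point, and \<open>Y\<close> maps it into
    \<open>C\<close>; without this the maximum would be unspecified.\<close>
  have ne: "C \<noteq> {}"
    using not_empty measurable_space[OF Y] by auto
  have [measurable]: "m \<in> borel_measurable ?P"
    unfolding m_def using C ne by measurable
  have le_m: "?p y z \<le> m z" if "y \<in> C" for y z
    unfolding m_def using C that by simp
  have m_nonneg: "0 \<le> m z" for z
    using ne le_m cond_prob_at_nonneg by (meson all_not_in_conv order_trans)
  have int_m: "integrable ?P m"
  proof (rule P.integrable_const_bound[where B = 1])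
    have "AE z in ?P. \<forall>y\<in>C. ?p y z \<le> 1"
      using C AE_cond_prob_at_le_1[OF C Y Z] by (intro AE_finite_allI)
    then show "AE z in ?P. norm (m z) \<le> 1"
      by eventually_elim (use C ne m_nonneg in \<open>auto simp: m_def\<close>)
  qed measurable
  \<comment> \<open>A maximum of \<open>card C\<close> numbers with sum 1 is at least their average.
    This makes \<open>E\<close> positive, as the logarithm and the division by \<open>E\<close>
    require.\<close>
  have "(\<integral>z. 1 / card C \<partial>?P) \<le> E"
    unfolding E_def
  proof (rule integral_mono_AE)
    show "AE z in ?P. 1 / card C \<le> m z"
      using AE_sum_cond_prob_at[OF C Y Z]
    proof eventually_elim
      case (elim z)
      then have "1 \<le> card C * m z"
        using sum_bounded_above[of C "\<lambda>y. ?p y z" "m z"] le_m by simp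
      then show ?case using C ne by (simp add: field_simps card_gt_0_iff)
    qed
  qed (use int_m in auto)
  then have "1 / card C \<le> E"
    using P.prob_space by simp
  moreover have "0 < 1 / real (card C)"
    using C ne by (simp add: card_gt_0_iff)
  ultimately have E: "0 < E"
    by (rule less_le_trans[rotated])
  have "(\<Sum>y\<in>C. \<integral>z. ?p y z * ln (?p y z) \<partial>?P) = (\<integral>z. (\<Sum>y\<in>C. ?p y z * ln (?p y z)) \<partial>?P)"
    using integrable_cond_prob_at_ln[OF C Y Z] by simp
  \<comment> \<open>The right-hand side is affine in \<open>m z\<close>, so its integral is explicit
    and ln m never has to be shown integrable.\<close>
  also have "\<dots> \<le> (\<integral>z. ln E - 1 + m z / E \<partial>?P)"
  proof (rule integral_mono_AE)
    show "AE z in ?P. (\<Sum>y\<in>C. ?p y z * ln (?p y z)) \<le> ln E - 1 + m z / E"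
      using AE_sum_cond_prob_at[OF C Y Z]
    proof eventually_elim
      case (elim z)
      \<comment> \<open>The upper bound on the logarithm does not depend on y, so averaging with
        weights of sum 1 leaves it unchanged.\<close>
      have "(\<Sum>y\<in>C. ?p y z * ln (?p y z)) \<le> (\<Sum>y\<in>C. ?p y z * (ln E - 1 + m z / E))"
      proof (rule sum_mono)
        fix y assume y: "y \<in> C"
        show "?p y z * ln (?p y z) \<le> ?p y z * (ln E - 1 + m z / E)"
        proof (cases "?p y z = 0")
          case False
          then have p: "0 < ?p y z" using cond_prob_at_nonneg[of MZ Z Y y z] by simp
          then have "ln (?p y z) \<le> ln E - 1 + ?p y z / E"
            using ln_le_minus_one[of "?p y z / E"] E by (simp add: ln_div)
          also have "\<dots> \<le> ln E - 1 + m z / E"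
            using le_m[OF y] E by (simp add: divide_right_mono)
          finally show ?thesis using p by (intro mult_left_mono) auto
        qed simp
      qed
      also have "\<dots> = ln E - 1 + m z / E"
        using elim by (simp flip: sum_distrib_right)
      finally show ?case .
    qed
  qed (use int_m integrable_cond_prob_at_ln[OF C Y Z] in auto)
  \<comment> \<open>The integral of \<open>m z / E\<close> is 1, which cancels the -1 of the tangent
    bound.\<close>
  also have "\<dots> = ln E"
    using int_m E P.prob_space by (simp add: E_def[symmetric])
  finally have "exp (\<Sum>y\<in>C. \<integral>z. ?p y z * ln (?p y z) \<partial>?P) \<le> E"
    using E by (metis exp_le_cancel_iff exp_ln)
  then show ?thesis
    by (simp add: bayes_error_rate_def entropy_minus_mutual_information[OF assms] E_def m_def)
qed

end

theorem theorem1: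
  fixes M :: "'a measure" and MZ :: "'b measure" and MV :: "'d measure"
    and C :: "'c set"
    and Y :: "'a \<Rightarrow> 'c" and Z :: "'a \<Rightarrow> 'b" and V :: "'a \<Rightarrow> 'd"
  assumes "prob_space M"
    and "finite C"
    and "Y \<in> measurable M (count_space C)"
    and "Z \<in> measurable M MZ"
    and "V \<in> measurable M MV"
  shows "prob_space.bayes_error_rate M MZ C Z Y
      \<le> 1 - exp (- (prob_space.entropy M (exp 1) (count_space C) Y
                    - prob_space.mutual_information M (exp 1) MZ (count_space C) Z Y))
    \<and> 1 - exp (- (prob_space.entropy M (exp 1) (count_space C) Y
                    - prob_space.mutual_information M (exp 1) MZ (count_space C) Z Y))
      \<le> 1 - exp (- (prob_space.entropy M (exp 1) (count_space C) Y
                    - prob_space.interaction_information M (exp 1) MZ (count_space C) MV Z Y V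
                    - prob_space.conditional_mutual_information M (exp 1)
                        (count_space C) MZ MV Y Z V))"
proof
  interpret prob_space M by fact
  show "bayes_error_rate MZ C Z Y
      \<le> 1 - exp (- (entropy (exp 1) (count_space C) Y - mutual_information (exp 1) MZ (count_space C) Z Y))"
    using assms(2-4) by (rule bayes_error_rate_le)
  \<comment> \<open>The conditional term occurs in \<open>interaction_information\<close> with the
    same order of arguments, so it cancels as a real number and the two exponents agree.\<close>
  show "1 - exp (- (entropy (exp 1) (count_space C) Y - mutual_information (exp 1) MZ (count_space C) Z Y))
      \<le> 1 - exp (- (entropy (exp 1) (count_space C) Y
          - interaction_information (exp 1) MZ (count_space C) MV Z Y V
          - conditional_mutual_information (exp 1) (count_space C) MZ MV Y Z V))"
    by (simp add: interaction_information_def)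
qed

end
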